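(* Let $z\in\mathbb{C}\setminus(-\infty,0]$ and let $a,b\in\mathbb{C}$ with $b\notin\mathbb{Z}$, $a\notin\{-1,-2,-3,\ldots\}$ and $a-b+1\notin\{0,-1,-2,\ldots\}$. Define $w_0$ by $$b\,w_0=\frac{\Gamma(a+1)}{\Gamma(b+1)}-z^{-b}\,\frac{\Gamma(a-b+1)}{\Gamma(2-b)}.$$ Then $$w_0=\frac{\Gamma(a+1)}{(b-1)\bigl(1-b\,\Gamma(a+1)\,G(a,-b)\bigr)}\Bigl(\Gamma(a+1)(1-b)\bigl(1+b\,G(0,b)\bigr)G(a,-b)+1+(b-1)G(0,b)-G(0,-b)+\frac{z^{-b}-1}{b}\bigl(1-b\,G(0,-b)\bigr)\Bigr).$$
   Context: For complex $a$ and $b\neq0$, $$G(a,b)=\frac1b\left(\frac{1}{\Gamma(a+1+b)}-\frac{1}{\Gamma(a+1)}\right),$$ where $1/\Gamma$ is the entire reciprocal gamma function. The power $z^{-b}$ is principal. *)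

theory Defs
  imports "HOL-Analysis.Analysis"
begin

text \<open>The function is only meant for \<open>b \<noteq> 0\<close>; at \<open>b = 0\<close> the definition yields the junk value 0.
  \<open>rGamma\<close> is the entire reciprocal Gamma function.\<close>

definition G :: "complex \<Rightarrow> complex \<Rightarrow> complex" where
  "G a b = (1 / b) * (rGamma (a + 1 + b) - rGamma (a + 1))"

end

theory Submission
  imports Defs
begin

text \<open>
  Every occurrence of \<open>G\<close> in the claim is multiplied by \<open>b\<close> once the outer \<open>1 / b\<close> is pulled
  out, and \<open>b G\<close> is a plain difference of reciprocal Gamma values. In particular
  \<open>1 - b \<Gamma>(a+1) G(a,-b) = \<Gamma>(a+1) / \<Gamma>(a-b+1)\<close>, so the prefactor
  collapses to \<open>\<Gamma>(a-b+1) / (b-1)\<close>, while the second factor collapses to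
  \<open>((b-1) \<Gamma>(a+1) / (\<Gamma>(b+1) \<Gamma>(a-b+1)) + z\<^sup>-\<^sup>b / \<Gamma>(1-b)) / b\<close>, because after expansion all terms
  without \<open>\<Gamma>(a+1)\<close> or \<open>z\<^sup>-\<^sup>b\<close> cancel. The product is the defining expression of \<open>w\<^sub>0\<close> once
  \<open>\<Gamma>(2-b) = (1-b) \<Gamma>(1-b)\<close> is used.
\<close>

lemma mult_G:
  assumes "b \<noteq> 0"
  shows "b * G a b = rGamma (a + 1 + b) - rGamma (a + 1)"
  using assms by (simp add: G_def)

lemma mult_G_minus:
  assumes "b \<noteq> 0"
  shows "b * G a (- b) = rGamma (a + 1) - rGamma (a - b + 1)"
  using mult_G[of "- b" a] assms by (simp add: algebra_simps)

text \<open>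
  The cancellation, with the Gamma values replaced by independent quantities:
  \<open>A = \<Gamma>(a+1)\<close>, \<open>C = \<Gamma>(a-b+1)\<close>, \<open>r = 1 / \<Gamma>(b+1)\<close>, \<open>s = 1 / \<Gamma>(1-b)\<close>, \<open>t = z\<^sup>-\<^sup>b\<close>, and
  \<open>g\<close>, \<open>p\<close>, \<open>q\<close> for \<open>G(a,-b)\<close>, \<open>G(0,b)\<close>, \<open>G(0,-b)\<close>.
\<close>

lemma bracket_identity:
  fixes A C b g p q r s t :: complex
  assumes b: "b \<noteq> 0" "b \<noteq> 1" and A: "A \<noteq> 0" and C: "C \<noteq> 0"
    and g: "b * g = 1 / A - 1 / C" and p: "b * p = r - 1" and q: "b * q = 1 - s"
  shows "A / ((b - 1) * (1 - b * A * g)) *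
           (A * (1 - b) * (1 + b * p) * g + 1 + (b - 1) * p - q + (t - 1) / b * (1 - b * q))
         = (A * r - t * (C * (s / (1 - b)))) / b"
proof -
  have g': "g = (1 / A - 1 / C) / b" and p': "p = (r - 1) / b" and q': "q = (1 - s) / b"
    using g p q b(1) by (simp_all add: field_simps)
  have "1 - b * A * g = A / C"
    using A b(1) C by (simp add: g' field_simps)
  then have prefactor: "A / ((b - 1) * (1 - b * A * g)) = C / (b - 1)"
    using A by simp
  have bracket: "A * (1 - b) * (1 + b * p) * g + 1 + (b - 1) * p - q + (t - 1) / b * (1 - b * q)
      = ((b - 1) * r * A / C + t * s) / b"
    using A b(1) C by (simp add: g' p' q' field_simps)
  have "C / (b - 1) * (((b - 1) * r * A / C + t * s) / b)
      = (A * r - t * (C * (s / (1 - b)))) / b"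
    using b C by (simp add: divide_simps) (simp add: algebra_simps)
  then show ?thesis
    unfolding prefactor bracket .
qed

theorem mainTheorem2:
  fixes z a b w0 :: complex
  assumes "z \<notin> \<real>\<^sub>\<le>\<^sub>0"
    and "b \<notin> \<int>"
    and "a \<notin> {- of_nat n | n. n \<ge> 1}"
    and "a - b + 1 \<notin> \<int>\<^sub>\<le>\<^sub>0"
    and "b * w0 = Gamma (a + 1) / Gamma (b + 1)
                  - z powr (- b) * (Gamma (a - b + 1) / Gamma (2 - b))"
  shows "w0 = Gamma (a + 1) / ((b - 1) * (1 - b * Gamma (a + 1) * G a (- b))) *
           (Gamma (a + 1) * (1 - b) * (1 + b * G 0 b) * G a (- b)
            + 1 + (b - 1) * G 0 b - G 0 (- b)
            + (z powr (- b) - 1) / b * (1 - b * G 0 (- b)))"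
proof -
  have b: "b \<noteq> 0" "b \<noteq> 1"
    using assms(2) by auto
  have "a + 1 \<notin> \<int>\<^sub>\<le>\<^sub>0"
  proof
    assume "a + 1 \<in> \<int>\<^sub>\<le>\<^sub>0"
    then obtain n where "a + 1 = - of_nat n"
      by (elim nonpos_Ints_cases')
    then have "a = - of_nat (Suc n)"
      by (simp add: algebra_simps eq_neg_iff_add_eq_0)
    with assms(3) show False
      by (metis (mono_tags, lifting) mem_Collect_eq le_add1 plus_1_eq_Suc)
  qed
  then have A: "Gamma (a + 1) \<noteq> 0"
    by (simp add: Gamma_eq_zero_iff)
  have C: "Gamma (a - b + 1) \<noteq> 0"
    using assms(4) by (simp add: Gamma_eq_zero_iff)
  have g: "b * G a (- b) = 1 / Gamma (a + 1) - 1 / Gamma (a - b + 1)"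
    using mult_G_minus[OF b(1)] by (simp add: rGamma_inverse_Gamma inverse_eq_divide)
  have p: "b * G 0 b = rGamma (b + 1) - 1"
    using mult_G[OF b(1), of 0] by (simp add: add.commute)
  have q: "b * G 0 (- b) = 1 - rGamma (1 - b)"
    using mult_G_minus[OF b(1), of 0] by simp
  have "(1 - b) * rGamma (2 - b) = rGamma (1 - b)"
    using rGamma_plus1[of "1 - b"] by (simp add: algebra_simps)
  then have rG: "rGamma (2 - b) = rGamma (1 - b) / (1 - b)"
    using b(2) by (simp add: field_simps)
  have "b * w0 = Gamma (a + 1) * rGamma (b + 1)
                 - z powr (- b) * (Gamma (a - b + 1) * rGamma (2 - b))"
    using assms(5) by (simp add: rGamma_inverse_Gamma divide_inverse)
  then have "w0 = (Gamma (a + 1) * rGamma (b + 1)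
      - z powr (- b) * (Gamma (a - b + 1) * (rGamma (1 - b) / (1 - b)))) / b"
    unfolding rG using b(1) by (simp add: eq_divide_eq mult.commute)
  also note bracket_identity[OF b A C g p q, symmetric]
  finally show ?thesis .
qed

end
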